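(* Let $(a_n)_{n\geq1}$ be a sequence of integers such that for some $t \in \mathbb{N}$ we have $|a_n| \leq n^t$ for all sufficiently large $n$. Assume there exist $\tau \in (0,1)$, reals $1 < B' < B$, and a strictly increasing sequence $(B_L)_{L\geq1}$ of positive integers with $(B')^L \leq B_L \leq B^L$ for all $L$, such that for every $\varepsilon > 0$ there is $L(\varepsilon)$ with $$\int_0^1 \left| \sum_{n=1}^{B_L} e^{2\pi i a_n \alpha} \right| d\alpha > B_L^{\tau - \varepsilon} \qquad \text{for all } L > L(\varepsilon).$$ Then for almost all $\alpha \in [0,1)$ the discrepancy $D_N$ of $(\{a_n\alpha\})_{n\geq1}$ satisfies: for every $\varepsilon>0$ there are infinitely many $N$ with $N D_N > N^{\tau - \varepsilon}$.
   Context: For real $x$, $\{x\}$ denotes the fractional part of $x$. For a sequence $(x_n)_{n\ge1}$ in $[0,1)$, its discrepancy is $$D_N = \sup_{0 \leq a < b \leq 1} \left| \frac{A_N([a,b))}{N} - (b-a) \right|, \qquad A_N([a,b)) = \#\{1 \leq n \leq N : x_n \in [a,b)\}.$$ *)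

theory Defs
  imports "HOL-Analysis.Analysis"
begin

definition count_in :: "(nat \<Rightarrow> real) \<Rightarrow> nat \<Rightarrow> real \<Rightarrow> real \<Rightarrow> nat" where
  "count_in x N a b = card {n \<in> {1..N}. a \<le> x n \<and> x n < b}"

definition discrepancy :: "(nat \<Rightarrow> real) \<Rightarrow> nat \<Rightarrow> real" where
  "discrepancy x N =
     (SUP ab \<in> {(a, b). 0 \<le> a \<and> a < b \<and> b \<le> (1::real)}.
        \<bar>real (count_in x N (fst ab) (snd ab)) / real N - (snd ab - fst ab)\<bar>)"

end

theory Submission
  imports Defs "HOL-Computational_Algebra.Primes" "HOL-Real_Asymp.Real_Asymp"
begin

text \<open>
  Write \<open>N = B\<^sub>L\<close> and \<open>S(x) = \<Sum>n\<le>N. e(a\<^sub>n x)\<close>. Koksma's inequality applied to the \<open>p\<close>-th harmonic gives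
  \<open>|S(p\<alpha>)| \<le> 2\<pi> p N D\<^sub>N(\<alpha>)\<close> for every \<open>p\<close>, so it suffices to find a small \<open>p\<close> for which
  \<open>|S(p\<alpha>)|\<close> is large. By dyadic pigeonholing there is a level \<open>y\<close> such that the set where
  \<open>|S| \<ge> y\<close> has measure \<open>\<mu>\<close> with \<open>y\<mu>\<close> at least \<open>\<integral>|S|\<close> up to a logarithm. For almost every
  \<open>\<alpha>\<close> this set is hit by \<open>p\<alpha>\<close> for some prime \<open>p \<le> H\<close>, where \<open>H\<close> is slightly larger than
  \<open>1/\<mu>\<close>: replace the indicator of the set by the trigonometric polynomial
  \<open>\<phi> = 1 - (1 - (|S|/N)\<^bsup>2r\<^esup>)\<^bsup>d\<^esup>\<close> with \<open>d \<approx> (N/y)\<^bsup>2r\<^esup>\<close>, whose degree is polynomial in \<open>N\<close>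
  because of the growth condition. A frequency of polynomial size has only \<open>O(log N)\<close> prime
  divisors, so the variance of \<open>\<Sum>p\<le>H. \<phi>(p\<alpha>)\<close> is at most \<open>O(log N)\<close> times its mean, and
  Chebyshev's inequality and the Borel--Cantelli lemma apply. Then
  \<open>N D\<^sub>N(\<alpha>)\<close> is essentially at least \<open>y/H \<approx> y\<mu>\<close>.
\<close>

section \<open>Exponential sums on the unit interval\<close>

definition e1 :: "real \<Rightarrow> complex" where
  "e1 x = cis (2 * pi * x)"

lemma norm_e1 [simp]: "norm (e1 x) = 1"
  by (simp add: e1_def)

lemma e1_add: "e1 (x + y) = e1 x * e1 y"
  by (simp add: e1_def cis_mult distrib_left)

lemma cnj_e1: "cnj (e1 x) = e1 (- x)"
  by (simp add: e1_def cis_cnj)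

lemma e1_of_int [simp]: "e1 (of_int k) = 1"
  by (simp add: e1_def cis_multiple_2pi)

lemma e1_0 [simp]: "e1 0 = 1"
  by (simp add: e1_def)

lemma e1_int_frac: "e1 (of_int k * frac x) = e1 (of_int k * x)"
proof -
  have "of_int k * x = of_int k * frac x + of_int (k * \<lfloor>x\<rfloor>)"
    by (simp add: frac_def algebra_simps)
  then show ?thesis
    by (simp only: e1_add e1_of_int mult_1_right)
qed

lemma continuous_on_e1 [continuous_intros]:
  "continuous_on A f \<Longrightarrow> continuous_on A (\<lambda>x. e1 (f x))"
  unfolding e1_def by (intro continuous_intros) auto

lemma e1_has_vector_derivative:
  "((\<lambda>x. e1 (c * x)) has_vector_derivative (2 * pi * \<i> * c * e1 (c * x))) (at x within A)"
proof -
  have "((\<lambda>x. exp (\<i> * of_real (2 * pi * c) * x)) has_field_derivative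
      (\<i> * of_real (2 * pi * c) * exp (\<i> * of_real (2 * pi * c) * of_real x))) (at (of_real x))"
    by (auto intro!: derivative_eq_intros)
  from has_vector_derivative_real_field[OF this] show ?thesis
    by (simp add: e1_def cis_conv_exp mult_ac)
qed

text \<open>Lebesgue measure on \<open>{0..1}\<close> as a space of total mass 1, so that constants
  are integrable and Markov's inequality applies directly. \<open>integral_unit_lborel\<close>
  translates back to set integrals.\<close>

abbreviation unit_lborel :: "real measure" where
  "unit_lborel \<equiv> restrict_space lborel {0..1}"

lemma space_unit_lborel [simp]: "space unit_lborel = {0..1}"
  by (simp add: space_restrict_space)

lemma measure_unit_lborel_space: "measure unit_lborel {0..1} = 1"
  by (simp add: measure_restrict_space)

lemma finite_measure_unit_lborel: "finite_measure unit_lborel"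
  by (rule finite_measureI) (simp add: emeasure_restrict_space)

lemma integrable_unit_lborel:
  fixes f :: "real \<Rightarrow> 'a::{banach, second_countable_topology}"
  assumes "continuous_on {0..1} f"
  shows "integrable unit_lborel f"
proof -
  have "set_integrable lborel {0..1} f"
    unfolding set_integrable_def by (rule borel_integrable_compact) (use assms in auto)
  then show ?thesis
    by (simp add: integrable_restrict_space set_integrable_def)
qed

lemma integral_unit_lborel:
  fixes f :: "real \<Rightarrow> 'a::{banach, second_countable_topology}"
  shows "(LINT x|unit_lborel. f x) = (LINT x:{0..1}|lborel. f x)"
  by (simp add: integral_restrict_space set_lebesgue_integral_def)

lemma integral_e1:
  "(LINT x|unit_lborel. e1 (of_int k * x)) = (if k = 0 then 1 else 0)"
proof (cases "k = 0")
  case True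
  then show ?thesis using measure_unit_lborel_space by simp
next
  case False
  define F where "F x = e1 (of_int k * x) / (2 * pi * \<i> * of_int k)" for x
  have "(F has_vector_derivative e1 (of_int k * x)) (at x within {0..1})" for x
    unfolding F_def using has_vector_derivative_divide[OF e1_has_vector_derivative[of "of_int k" x "{0..1}"],
        of "2 * pi * \<i> * of_int k"] False by simp
  then have "has_bochner_integral lborel (\<lambda>x. indicator {0..1} x *\<^sub>R e1 (of_int k * x)) (F 1 - F 0)"
    by (intro has_bochner_integral_FTC_Icc) (auto intro!: continuous_intros)
  then show ?thesis
    using False e1_of_int[of k]
    by (simp add: integral_unit_lborel set_lebesgue_integral_def has_bochner_integral_integral_eq F_def)
qed

text \<open>Expand the square and integrate termwise by orthogonality. The frequencies
  \<open>v i\<close> may coincide: for prime dilates the same integer arises as \<open>p * j\<close>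
  in several ways.\<close>

lemma integral_norm_sq_e1_sum:
  fixes w :: "'i \<Rightarrow> complex" and v :: "'i \<Rightarrow> int"
  assumes "finite I"
  shows "complex_of_real (LINT x|unit_lborel. (norm (\<Sum>i\<in>I. w i * e1 (of_int (v i) * x)))\<^sup>2)
    = (\<Sum>i\<in>I. \<Sum>j\<in>I. if v i = v j then w i * cnj (w j) else 0)"
proof -
  have eq: "complex_of_real ((norm (\<Sum>i\<in>I. w i * e1 (of_int (v i) * x)))\<^sup>2)
     = (\<Sum>i\<in>I. \<Sum>j\<in>I. w i * cnj (w j) * e1 (of_int (v i - v j) * x))" for x
  proof -
    have "e1 (of_int (v i - v j) * x) = e1 (of_int (v i) * x) * cnj (e1 (of_int (v j) * x))" for i j
      by (simp add: cnj_e1 e1_add[symmetric] algebra_simps)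
    then show ?thesis
      by (simp add: complex_norm_square sum_product mult_ac del: of_int_diff of_real_power)
  qed
  have int: "integrable unit_lborel (\<lambda>x. c * e1 (of_int k * x))" for c k
    by (intro integrable_unit_lborel continuous_intros)
  have "complex_of_real (LINT x|unit_lborel. (norm (\<Sum>i\<in>I. w i * e1 (of_int (v i) * x)))\<^sup>2)
     = (LINT x|unit_lborel. complex_of_real ((norm (\<Sum>i\<in>I. w i * e1 (of_int (v i) * x)))\<^sup>2))"
    by (rule integral_complex_of_real[symmetric])
  also have "\<dots> = (LINT x|unit_lborel. (\<Sum>i\<in>I. \<Sum>j\<in>I. w i * cnj (w j) * e1 (of_int (v i - v j) * x)))"
    by (simp only: eq)
  also have "\<dots> = (\<Sum>i\<in>I. \<Sum>j\<in>I. LINT x|unit_lborel. w i * cnj (w j) * e1 (of_int (v i - v j) * x))"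
    by (subst Bochner_Integration.integral_sum, (intro Bochner_Integration.integrable_sum int)[])
       (intro sum.cong refl Bochner_Integration.integral_sum int)
  also have "\<dots> = (\<Sum>i\<in>I. \<Sum>j\<in>I. w i * cnj (w j) * (if v i - v j = 0 then 1 else 0))"
    by (simp only: integral_mult_right_zero integral_e1)
  finally show ?thesis
    by (auto intro!: sum.cong simp: if_distrib cong: if_cong)
qed

lemma parseval_e1_sum:
  fixes w :: "'i \<Rightarrow> complex" and v :: "'i \<Rightarrow> int"
  assumes "finite I" "inj_on v I"
  shows "(LINT x|unit_lborel. (norm (\<Sum>i\<in>I. w i * e1 (of_int (v i) * x)))\<^sup>2) = (\<Sum>i\<in>I. (norm (w i))\<^sup>2)"
proof -
  have "(\<Sum>j\<in>I. if v i = v j then w i * cnj (w j) else 0) = w i * cnj (w i)" if "i \<in> I" for i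
  proof -
    have "(\<Sum>j\<in>I. if v i = v j then w i * cnj (w j) else 0) = (\<Sum>j\<in>I. if i = j then w i * cnj (w j) else 0)"
      using assms(2) that by (intro sum.cong) (auto simp: inj_on_def)
    then show ?thesis using assms(1) that by simp
  qed
  then have "complex_of_real (LINT x|unit_lborel. (norm (\<Sum>i\<in>I. w i * e1 (of_int (v i) * x)))\<^sup>2)
     = complex_of_real (\<Sum>i\<in>I. (norm (w i))\<^sup>2)"
    by (simp add: integral_norm_sq_e1_sum[OF assms(1)] complex_norm_square del: of_real_power)
  then show ?thesis by (simp only: of_real_eq_iff)
qed

text \<open>Only pairs with equal frequency survive integration. Each product is split by
  \<open>2ab \<le> a\<^sup>2 + b\<^sup>2\<close>, and by symmetry every
  \<open>(norm (w i))\<^sup>2\<close> is charged once for each index sharing its frequency.\<close>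

lemma integral_norm_sq_e1_sum_le:
  fixes w :: "'i \<Rightarrow> complex" and v :: "'i \<Rightarrow> int"
  assumes fin: "finite I" and W: "\<And>i. i \<in> I \<Longrightarrow> real (card {j\<in>I. v j = v i}) \<le> W"
  shows "(LINT x|unit_lborel. (norm (\<Sum>i\<in>I. w i * e1 (of_int (v i) * x)))\<^sup>2) \<le> W * (\<Sum>i\<in>I. (norm (w i))\<^sup>2)"
proof -
  define g where "g i = (norm (w i))\<^sup>2" for i
  define A where "A = (LINT x|unit_lborel. (norm (\<Sum>i\<in>I. w i * e1 (of_int (v i) * x)))\<^sup>2)"
  have "A = norm (complex_of_real A)"
    unfolding A_def by simp
  also have "\<dots> = norm (\<Sum>i\<in>I. \<Sum>j\<in>I. if v i = v j then w i * cnj (w j) else 0)"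
    unfolding A_def integral_norm_sq_e1_sum[OF fin] ..
  also have "\<dots> \<le> (\<Sum>i\<in>I. \<Sum>j\<in>I. norm (if v i = v j then w i * cnj (w j) else 0))"
    by (intro order.trans[OF norm_sum] sum_mono norm_sum)
  also have "\<dots> \<le> (\<Sum>i\<in>I. \<Sum>j\<in>I. (if v i = v j then g i / 2 else 0) + (if v j = v i then g j / 2 else 0))"
  proof (intro sum_mono)
    fix i j
    have "norm (w i) * norm (w j) \<le> (g i + g j) / 2"
      unfolding g_def using sum_squares_bound[of "norm (w i)" "norm (w j)"] by simp
    then show "norm (if v i = v j then w i * cnj (w j) else 0)
        \<le> (if v i = v j then g i / 2 else 0) + (if v j = v i then g j / 2 else 0)"
      by (simp add: norm_mult)
  qed
  also have "\<dots> = (\<Sum>i\<in>I. \<Sum>j\<in>I. if v i = v j then g i / 2 else 0)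
      + (\<Sum>j\<in>I. \<Sum>i\<in>I. if v j = v i then g j / 2 else 0)"
    unfolding sum.distrib
    by (intro arg_cong2[where f = "(+)"] refl sum.swap)
  also have "\<dots> = (\<Sum>i\<in>I. \<Sum>j\<in>I. if v j = v i then g i else 0)"
    unfolding sum.distrib[symmetric] by (intro sum.cong) auto
  also have "\<dots> = (\<Sum>i\<in>I. real (card {j\<in>I. v j = v i}) * g i)"
    using fin by (intro sum.cong refl) (simp add: sum.If_cases Int_def)
  also have "\<dots> \<le> (\<Sum>i\<in>I. W * g i)"
    by (intro sum_mono mult_right_mono W) (auto simp: g_def)
  finally show ?thesis by (simp add: A_def g_def sum_distrib_left)
qed

section \<open>Trigonometric polynomials\<close>

text \<open>\<open>J\<close> bounds the degree without having to equal it. The coefficients stay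
  existential because the variance bound recovers all it needs from integrals: the constant term is
  the mean, and Parseval gives the sum of squares.\<close>

definition trig_poly :: "nat \<Rightarrow> (real \<Rightarrow> complex) \<Rightarrow> bool" where
  "trig_poly J f \<longleftrightarrow> (\<exists>c. \<forall>x. f x = (\<Sum>j\<in>{-int J..int J}. c j * e1 (of_int j * x)))"

lemma trig_poly_e1:
  assumes "\<bar>k\<bar> \<le> int J"
  shows "trig_poly J (\<lambda>x. e1 (of_int k * x))"
proof -
  have "e1 (of_int k * x) = (\<Sum>j\<in>{-int J..int J}. (if j = k then 1 else 0) * e1 (of_int j * x))" for x
    using assms by (simp add: if_distrib[of "\<lambda>a. a * _"] abs_le_iff cong: if_cong)
  then show ?thesis unfolding trig_poly_def
    by (intro exI[of _ "\<lambda>j. if j = k then 1 else 0"]) blast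
qed

lemma trig_poly_add:
  assumes "trig_poly J f" "trig_poly J g"
  shows "trig_poly J (\<lambda>x. f x + g x)"
proof -
  obtain c d where "\<And>x. f x = (\<Sum>j\<in>{-int J..int J}. c j * e1 (of_int j * x))"
     "\<And>x. g x = (\<Sum>j\<in>{-int J..int J}. d j * e1 (of_int j * x))"
    using assms by (auto simp: trig_poly_def)
  then show ?thesis unfolding trig_poly_def
    by (intro exI[of _ "\<lambda>j. c j + d j"]) (simp add: sum.distrib distrib_right)
qed

lemma trig_poly_const_mult:
  assumes "trig_poly J f"
  shows "trig_poly J (\<lambda>x. a * f x)"
proof -
  obtain c where "\<And>x. f x = (\<Sum>j\<in>{-int J..int J}. c j * e1 (of_int j * x))"
    using assms by (auto simp: trig_poly_def)
  then show ?thesis unfolding trig_poly_def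
    by (intro exI[of _ "\<lambda>j. a * c j"]) (simp add: sum_distrib_left mult_ac)
qed

lemma trig_poly_const: "trig_poly J (\<lambda>x. a)"
  using trig_poly_const_mult[OF trig_poly_e1[of 0 J], of a] by simp

lemma trig_poly_diff:
  assumes "trig_poly J f" "trig_poly J g"
  shows "trig_poly J (\<lambda>x. f x - g x)"
  using trig_poly_add[OF assms(1) trig_poly_const_mult[OF assms(2), of "-1"]] by simp

lemma trig_poly_sum:
  assumes "\<And>i. i \<in> I \<Longrightarrow> trig_poly J (f i)"
  shows "trig_poly J (\<lambda>x. \<Sum>i\<in>I. f i x)"
  using assms
  by (induction I rule: infinite_finite_induct) (auto intro: trig_poly_add trig_poly_const)

lemma trig_poly_mult:
  assumes "trig_poly J f" "trig_poly K g"
  shows "trig_poly (J + K) (\<lambda>x. f x * g x)"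
proof -
  obtain c d where c: "\<And>x. f x = (\<Sum>j\<in>{-int J..int J}. c j * e1 (of_int j * x))"
     and d: "\<And>x. g x = (\<Sum>j\<in>{-int K..int K}. d j * e1 (of_int j * x))"
    using assms by (auto simp: trig_poly_def)
  have "f x * g x = (\<Sum>j\<in>{-int J..int J}. \<Sum>k\<in>{-int K..int K}. (c j * d k) * e1 (of_int (j + k) * x))" for x
    unfolding c d sum_product by (intro sum.cong) (auto simp: distrib_right e1_add)
  moreover have "trig_poly (J + K) (\<lambda>x. \<Sum>j\<in>{-int J..int J}. \<Sum>k\<in>{-int K..int K}.
      (c j * d k) * e1 (of_int (j + k) * x))"
    by (intro trig_poly_sum trig_poly_const_mult trig_poly_e1) auto
  ultimately show ?thesis by simp
qed

lemma trig_poly_power: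
  assumes "trig_poly J f"
  shows "trig_poly (n * J) (\<lambda>x. f x ^ n)"
  by (induction n) (use trig_poly_mult[OF assms] in \<open>auto intro: trig_poly_const\<close>)

lemma trig_poly_cnj:
  assumes "trig_poly J f"
  shows "trig_poly J (\<lambda>x. cnj (f x))"
proof -
  obtain c where "\<And>x. f x = (\<Sum>j\<in>{-int J..int J}. c j * e1 (of_int j * x))"
    using assms by (auto simp: trig_poly_def)
  then have "cnj (f x) = (\<Sum>j\<in>{-int J..int J}. cnj (c j) * e1 (of_int (-j) * x))" for x
    by (simp add: cnj_e1)
  moreover have "trig_poly J (\<lambda>x. \<Sum>j\<in>{-int J..int J}. cnj (c j) * e1 (of_int (-j) * x))"
    by (intro trig_poly_sum trig_poly_const_mult trig_poly_e1) auto
  ultimately show ?thesis by simp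
qed

lemma trig_poly_continuous_on:
  assumes "trig_poly J f"
  shows "continuous_on A f"
proof -
  obtain c where "f = (\<lambda>x. \<Sum>j\<in>{-int J..int J}. c j * e1 (of_int j * x))"
    using assms by (auto simp: trig_poly_def fun_eq_iff)
  then show ?thesis by (auto intro!: continuous_intros)
qed

section \<open>Koksma's inequality for exponentials\<close>

text \<open>Integration by parts writes the sum as minus the integral of the counting error of
  \<open>[0,u)\<close> against the derivative of \<open>e1 (h * u)\<close>. The error is at most
  \<open>N * D_N\<close>, and the derivative has modulus \<open>2 * pi * h\<close>.\<close>

lemma norm_sum_e1_le_discrepancy:
  fixes x :: "nat \<Rightarrow> real" and h :: nat
  assumes x: "\<And>n. x n \<in> {0..<1}" and N: "N > 0" and h: "h > 0"
  shows "norm (\<Sum>n=1..N. e1 (real h * x n)) \<le> 2 * pi * h * (real N * discrepancy x N)"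
proof -
  define F where "F u = u *\<^sub>R e1 (real h * u)" for u
  define D where "D = real N * discrepancy x N"
  have e1h: "e1 (real h) = 1" using e1_of_int[of "int h"] by simp
  have der: "((\<lambda>u. e1 (real h * u)) has_vector_derivative (2 * pi * \<i> * h * e1 (real h * u))) (at u within A)" for u A
    using e1_has_vector_derivative[of "real h" u A] by simp
  \<comment> \<open>A supremum of reals bounds its members only if the set is bounded above; here
    each term is at most 2.\<close>
  have bdd: "bdd_above ((\<lambda>ab. \<bar>real (count_in x N (fst ab) (snd ab)) / real N - (snd ab - fst ab)\<bar>) `
      {(a, b). 0 \<le> a \<and> a < b \<and> b \<le> (1::real)})"
  proof (intro bdd_aboveI2[where M = 2], clarsimp)
    fix a b :: real assume ab: "0 \<le> a" "a < b" "b \<le> 1"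
    have "count_in x N a b \<le> card {1..N}" unfolding count_in_def by (intro card_mono) auto
    then have "real (count_in x N a b) / real N \<le> 1" using N by simp
    moreover have "real (count_in x N a b) / real N \<ge> 0" by simp
    ultimately show "\<bar>real (count_in x N a b) / real N - (b - a)\<bar> \<le> 2" using ab by linarith
  qed
  have D_nonneg: "D \<ge> 0"
  proof -
    have "\<bar>real (count_in x N 0 1) / real N - (1 - 0)\<bar> \<le> discrepancy x N"
      unfolding discrepancy_def by (rule order.trans[OF _ cSUP_upper[OF _ bdd, of "(0,1)"]]) auto
    then show ?thesis unfolding D_def by (intro mult_nonneg_nonneg) linarith+
  qed
  have count: "real (count_in x N 0 u) = (\<Sum>n=1..N. if x n < u then 1 else 0)" for u
  proof -
    have "{n \<in> {1..N}. 0 \<le> x n \<and> x n < u} = {n \<in> {1..N}. x n < u}" using x by auto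
    then show ?thesis by (simp add: count_in_def sum.If_cases Int_def)
  qed
  have A: "\<bar>(\<Sum>n=1..N. (if x n < u then 1 else 0) - u)\<bar> \<le> D" if u: "u \<in> {0..1}" for u
  proof (cases "u = 0")
    \<comment> \<open>The discrepancy ranges over \<open>a < b\<close>, so the empty interval is
      treated separately; its error is 0 because no \<open>x n\<close> is negative.\<close>
    case True
    then have "(\<Sum>n=1..N. (if x n < u then 1 else 0) - u) = 0"
      using x by (intro sum.neutral) (auto simp: not_less)
    then show ?thesis using D_nonneg by simp
  next
    case False
    then have "\<bar>real (count_in x N 0 u) / real N - (u - 0)\<bar> \<le> discrepancy x N"
      unfolding discrepancy_def using u
      by (intro order.trans[OF _ cSUP_upper[OF _ bdd, of "(0,u)"]]) auto
    then have "real N * \<bar>real (count_in x N 0 u) / real N - u\<bar> \<le> D"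
      unfolding D_def by (intro mult_left_mono) auto
    also have "real N * \<bar>real (count_in x N 0 u) / real N - u\<bar> = \<bar>real N * (real (count_in x N 0 u) / real N - u)\<bar>"
      by (simp add: abs_mult)
    also have "real N * (real (count_in x N 0 u) / real N - u) = (\<Sum>n=1..N. (if x n < u then 1 else 0) - u)"
      using N by (simp add: right_diff_distrib count sum_subtractf)
    finally show ?thesis .
  qed
  define G where "G u = 2 * pi * \<i> * h * e1 (real h * u)" for u
  have one: "((\<lambda>u. ((if x n < u then 1 else 0) - u) *\<^sub>R G u) has_integral (- e1 (real h * x n))) {0..1}" for n
  proof -
    have xn: "0 \<le> x n" "x n \<le> 1" using x[of n] by auto
    have "(G has_integral (e1 (real h * 1) - e1 (real h * x n))) {x n..1}"
      unfolding G_def by (rule fundamental_theorem_of_calculus[OF xn(2)]) (rule der)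
    then have "((\<lambda>u. if u \<in> {x n..1} then G u else 0) has_integral (1 - e1 (real h * x n))) {0..1}"
      using xn e1h by (subst has_integral_restrict) auto
    then have i1: "((\<lambda>u. (if x n < u then 1 else 0) *\<^sub>R G u) has_integral (1 - e1 (real h * x n))) {0..1}"
      by (rule has_integral_spike_finite[of "{x n}", rotated 2]) auto
    \<comment> \<open>The product rule for \<open>F\<close>, with \<open>e1 h = 1\<close> and the
      vanishing mean of \<open>e1 (h * u)\<close>, gives integral 1 for \<open>u * G u\<close>. This
      cancels the 1 in \<open>i1\<close> and leaves the single exponential.\<close>
    have j1: "((\<lambda>u. e1 (real h * u) + u *\<^sub>R G u) has_integral (F 1 - F 0)) {0..1}"
    proof (rule fundamental_theorem_of_calculus)
      fix u :: real
      show "(F has_vector_derivative e1 (real h * u) + u *\<^sub>R G u) (at u within {0..1})"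
        unfolding F_def G_def
        by (rule derivative_eq_intros der | simp)+
    qed simp
    have j2: "((\<lambda>u. e1 (real h * u)) has_integral 0) {0..1}"
    proof -
      have "set_integrable lborel {0..1} (\<lambda>u. e1 (real h * u))"
        unfolding set_integrable_def by (rule borel_integrable_compact) (auto intro!: continuous_intros)
      from set_borel_integral_eq_integral[OF this] show ?thesis
        using integral_e1[of "int h"] h by (simp add: integral_unit_lborel has_integral_iff)
    qed
    have i2: "((\<lambda>u. u *\<^sub>R G u) has_integral 1) {0..1}"
      using has_integral_diff[OF j1 j2] e1h by (simp add: F_def)
    show ?thesis
      using has_integral_diff[OF i1 i2] by (simp add: scaleR_diff_left)
  qed
  have "((\<lambda>u. \<Sum>n=1..N. ((if x n < u then 1 else 0) - u) *\<^sub>R G u) has_integral (\<Sum>n=1..N. - e1 (real h * x n))) {0..1}"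
    by (intro has_integral_sum one) auto
  then have "norm (\<Sum>n=1..N. - e1 (real h * x n)) \<le> (2 * pi * h * D) * measure lborel {0..1::real}"
  proof (rule has_integral_bound_real[rotated 2])
    fix u :: real assume u: "u \<in> {0..1} - {}"
    have "norm (\<Sum>n=1..N. ((if x n < u then 1 else 0) - u) *\<^sub>R G u)
        = \<bar>(\<Sum>n=1..N. (if x n < u then 1 else 0) - u)\<bar> * norm (G u)"
      by (simp only: scaleR_sum_left[symmetric] norm_scaleR)
    also have "\<dots> \<le> D * (2 * pi * h)"
      using A u D_nonneg by (intro mult_mono) (auto simp: G_def norm_mult)
    finally show "norm (\<Sum>n=1..N. ((if x n < u then 1 else 0) - u) *\<^sub>R G u) \<le> 2 * pi * h * D"
      by (simp add: mult_ac)
  qed (use D_nonneg in auto)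
  then show ?thesis by (simp add: D_def sum_negf)
qed

section \<open>Counting primes and prime divisors\<close>

text \<open>In Leibniz' harmonic triangle the entry \<open>1 / ((n + 1) * (n choose k))\<close> is an integral
  combination of \<open>1, 1/2, \<dots>, 1/(n + 1)\<close>.\<close>

lemma Suc_times_binomial_dvd_Lcm:
  assumes "k \<le> n"
  shows "Suc n * (n choose k) dvd Lcm {1..Suc n}"
  using assms
proof (induction k arbitrary: n)
  case 0
  then show ?case by (auto intro: dvd_Lcm)
next
  case (Suc k)
  then obtain m where m: "n = Suc m" "k \<le> m" by (cases n) auto
  define a where "a = Suc m * (m choose k)"
  define b where "b = Suc n * (n choose k)"
  define c where "c = Suc n * (n choose Suc k)"
  define Q where "Q = Lcm {1..Suc n}"
  have "a dvd Lcm {1..Suc m}" unfolding a_def using Suc m by blast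
  also have "\<dots> dvd Q" unfolding Q_def m by (rule Lcm_subset) auto
  finally have a: "a dvd Q" .
  have b: "b dvd Q" unfolding b_def Q_def using Suc by simp
  have c0: "c > 0" "a > 0" "b > 0" using Suc.prems m by (auto simp: c_def a_def b_def)
  have e1: "a = Suc k * (n choose Suc k)"
    unfolding a_def m using Suc_times_binomial[of k m] by simp
  have e2: "Suc k * (n choose Suc k) = (n - k) * (n choose k)"
    using binomial_absorb_comp[of n k] binomial_absorption[of k n] m
    by (metis Suc_times_binomial binomial_absorb_comp diff_Suc_1)
  \<comment> \<open>The recurrence of the harmonic triangle: the entry at \<open>(n, k+1)\<close> is
    the entry at \<open>(n-1, k)\<close> minus the entry at \<open>(n, k)\<close>. Multiplied by
    \<open>Q\<close>, it exhibits \<open>Q / c\<close> as a difference of two integers.\<close>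
  have key: "1 / real c = 1 / real a - 1 / real b"
  proof -
    define C D where "C = real (n choose Suc k)" and "D = real (n choose k)"
    have x: "C > 0" "D > 0" "real n - real k > 0"
      using Suc.prems by (auto simp: C_def D_def zero_less_binomial_iff)
    have "real (Suc k) * C = real (n - k) * D"
      using e2 unfolding C_def D_def by (metis of_nat_mult)
    then have "D = (real k + 1) * C / (real n - real k)"
      using x m by (simp add: field_simps)
    moreover have "real a = (real k + 1) * C" "real b = (real n + 1) * D" "real c = (real n + 1) * C"
      unfolding e1 b_def c_def C_def D_def by (simp_all add: algebra_simps)
    moreover have "1 / ((p + 1) * C) = 1 / ((q + 1) * C) - 1 / ((p + 1) * ((q + 1) * C / (p - q)))"
      if "p - q > 0" "q \<ge> 0" for p q :: real
      using that x by (simp add: divide_simps)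
    ultimately show ?thesis using x by simp
  qed
  obtain u v where u: "Q = a * u" and v: "Q = b * v" using a b by (elim dvdE)
  have "real Q / real a = real u" using c0 by (simp add: u)
  moreover have "real Q / real b = real v" using c0 by (simp add: v)
  ultimately have "real Q / real c = real u - real v"
    using key by (simp only: divide_inverse mult_1_left right_diff_distrib)
  then have "real Q = real c * (real u - real v)" using c0 by (simp add: field_simps)
  then have "real_of_int (int Q) = real_of_int (int c * (int u - int v))" by simp
  then have "int Q = int c * (int u - int v)" by (simp only: of_int_eq_iff)
  then have "int c dvd int Q" by simp
  then show ?case unfolding c_def Q_def by presburger
qed

text \<open>The central binomial coefficient is at least the average of row \<open>n\<close>, so
  \<open>n + 1\<close> times it is at least the row sum \<open>2 ^ n\<close>; and this multiple
  divides the lcm.\<close>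

lemma two_power_le_Lcm: "2 ^ n \<le> Lcm {1..Suc n}"
proof -
  have "2 ^ n = (\<Sum>k\<le>n. n choose k)" by (simp add: choose_row_sum)
  also have "\<dots> \<le> (\<Sum>k\<le>n. n choose (n div 2))" by (intro sum_mono binomial_maximum)
  also have "\<dots> = Suc n * (n choose (n div 2))" by simp
  also have "\<dots> \<le> Lcm {1..Suc n}"
  proof (rule dvd_imp_le)
    show "Suc n * (n choose (n div 2)) dvd Lcm {1..Suc n}"
      by (rule Suc_times_binomial_dvd_Lcm) simp
    have "Lcm {1..Suc n} \<noteq> 0" by (subst Lcm_0_iff) auto
    then show "Lcm {1..Suc n} > 0" by (rule neq0_conv[THEN iffD1])
  qed
  finally show ?thesis .
qed

text \<open>The multiplicity of \<open>p\<close> in an lcm is the maximum of its multiplicities in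
  the members. The condition \<open>k > 0\<close> excludes the empty set, whose lcm is 1.\<close>

lemma prime_power_dvd_Lcm_nat:
  fixes p :: nat
  assumes "finite A" "prime p" "p ^ k dvd Lcm A" "k > 0" "0 \<notin> A"
  shows "\<exists>a\<in>A. p ^ k dvd a"
  using assms
proof (induction A rule: finite_induct)
  case empty
  then show ?case by auto
next
  case (insert x A)
  have nz: "x \<noteq> 0" "Lcm A \<noteq> 0" using insert by (auto simp: Lcm_0_iff)
  have "k \<le> multiplicity p (lcm x (Lcm A))"
    using insert nz by (intro multiplicity_geI) (auto simp: lcm_eq_0_iff)
  also have "\<dots> = max (multiplicity p x) (multiplicity p (Lcm A))"
    using nz insert.prems by (intro multiplicity_lcm) auto
  finally have "p ^ k dvd x \<or> p ^ k dvd Lcm A"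
    by (metis le_max_iff_disj multiplicity_dvd')
  then show ?case using insert by auto
qed

text \<open>Each maximal prime power in the lcm divides some element of \<open>{1..m}\<close> and is
  therefore at most \<open>m\<close>.\<close>

lemma Lcm_atLeastAtMost_le:
  fixes m :: nat
  shows "Lcm {1..m} \<le> m ^ card {p. prime p \<and> p \<le> m}"
proof -
  define Q where "Q = Lcm {1..m}"
  have Q0: "Q \<noteq> 0" unfolding Q_def by (subst Lcm_0_iff) auto
  have sub: "prime_factors Q \<subseteq> {p. prime p \<and> p \<le> m}"
  proof
    fix p assume p: "p \<in> prime_factors Q"
    then have "\<exists>a\<in>{1..m}. p ^ 1 dvd a"
      unfolding Q_def by (intro prime_power_dvd_Lcm_nat) (auto simp: in_prime_factors_iff)
    then show "p \<in> {p. prime p \<and> p \<le> m}" using p by (auto dest: dvd_imp_le)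
  qed
  have "Q = (\<Prod>p\<in>prime_factors Q. p ^ multiplicity p Q)"
    using Q0 by (simp add: prime_factorization_nat)
  also have "\<dots> \<le> (\<Prod>p\<in>prime_factors Q. m)"
  proof (intro prod_mono conjI)
    fix p assume p: "p \<in> prime_factors Q"
    have "\<exists>a\<in>{1..m}. p ^ multiplicity p Q dvd a"
      using p multiplicity_dvd[of p Q]
      by (intro prime_power_dvd_Lcm_nat) (auto simp: Q_def prime_factors_multiplicity)
    then show "p ^ multiplicity p Q \<le> m" by (auto dest: dvd_imp_le)
  qed auto
  also have "\<dots> = m ^ card (prime_factors Q)" by simp
  also have "\<dots> \<le> m ^ card {p. prime p \<and> p \<le> m}"
  proof (cases "m = 0")
    case False
    then show ?thesis using sub by (intro power_increasing card_mono) auto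
  next
    case True
    then have "{p. prime p \<and> p \<le> m} = {}" by auto
    then show ?thesis using sub by (metis subset_empty le_refl)
  qed
  finally show ?thesis unfolding Q_def .
qed

text \<open>A Chebyshev-type bound: take logarithms in \<open>2 ^ (n - 1) \<le> Lcm {1..n} \<le> n ^
  card {p. prime p \<and> p \<le> n}\<close>. The constant comes from \<open>ln 2 \<ge> 2/3\<close>
  and \<open>n - 1 \<ge> n/2\<close>.\<close>

lemma card_primes_ge:
  assumes "n \<ge> 2"
  shows "real (card {p. prime p \<and> p \<le> n}) * ln (real n) \<ge> real n / 3"
proof -
  obtain m where m: "n = Suc m" "m \<ge> 1" using assms by (cases n) auto
  have "2 ^ m \<le> n ^ card {p. prime p \<and> p \<le> n}"
    using two_power_le_Lcm[of m] Lcm_atLeastAtMost_le[of n] m by simp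
  then have "real (2 ^ m) \<le> real (n ^ card {p. prime p \<and> p \<le> n})" by (simp only: of_nat_le_iff)
  then have "ln (2 ^ m) \<le> ln (real n ^ card {p. prime p \<and> p \<le> n})"
    using assms by simp
  then have "real m * ln 2 \<le> real (card {p. prime p \<and> p \<le> n}) * ln (real n)"
    using assms by (simp add: ln_realpow)
  moreover have "real m * (2/3) \<le> real m * ln 2"
    using ln2_ge_two_thirds by (intro mult_left_mono) auto
  moreover have "real n / 3 \<le> real m * (2/3)" using m by simp
  ultimately show ?thesis by linarith
qed

text \<open>Each distinct prime divisor contributes a factor of at least 2 to
  \<open>n\<close>.\<close>

lemma card_prime_divisors_le_log:
  fixes n :: nat
  assumes "n > 0"
  shows "real (card {p. prime p \<and> p dvd n}) \<le> log 2 (real n)"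
proof -
  have "{p. prime p \<and> p dvd n} = prime_factors n" using assms by (auto simp: in_prime_factors_iff)
  moreover have "2 ^ card (prime_factors n) \<le> n"
  proof -
    have "2 ^ card (prime_factors n) = (\<Prod>p\<in>prime_factors n. 2::nat)" by simp
    also have "\<dots> \<le> (\<Prod>p\<in>prime_factors n. p ^ multiplicity p n)"
    proof (intro prod_mono conjI)
      fix p assume p: "p \<in> prime_factors n"
      then have "p \<ge> 2" "multiplicity p n \<ge> 1"
        by (auto simp: in_prime_factors_iff prime_ge_2_nat prime_factors_multiplicity)
      then show "2 \<le> p ^ multiplicity p n"
        by (metis One_nat_def order.trans power_increasing power_one_right le_numeral_extra(4) one_le_numeral)
    qed auto
    also have "\<dots> = n" using assms by (simp add: prime_factorization_nat[symmetric])
    finally show ?thesis .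
  qed
  then have "real (2 ^ card (prime_factors n)) \<le> real n" by (simp only: of_nat_le_iff)
  ultimately show ?thesis using assms by (simp add: le_log_iff powr_realpow)
qed

section \<open>Prime dilates\<close>

text \<open>The centred sum has frequencies \<open>p * j\<close> with \<open>j \<noteq> 0\<close>.
  For a fixed value of \<open>p * j\<close>, the prime \<open>p\<close> is one of its divisors and
  determines \<open>j\<close>, so a frequency repeats at most \<open>log 2 (J * H)\<close> times.
  The squared coefficients sum to at most \<open>m\<close> for each prime, by Parseval and
  \<open>\<phi>\<^sup>2 \<le> \<phi>\<close>.\<close>

lemma variance_prime_dilates:
  fixes \<phi> :: "real \<Rightarrow> real" and P :: "nat set"
  assumes tp: "trig_poly J (\<lambda>x. complex_of_real (\<phi> x))" and J: "J > 0"
    and bd: "\<And>x. 0 \<le> \<phi> x \<and> \<phi> x \<le> 1"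
    and P: "finite P" "\<And>p. p \<in> P \<Longrightarrow> prime p \<and> p \<le> H"
    and m: "m = (LINT x|unit_lborel. \<phi> x)"
  shows "(LINT x|unit_lborel. ((\<Sum>p\<in>P. \<phi> (real p * x)) - real (card P) * m)\<^sup>2)
      \<le> log 2 (real J * real H) * (real (card P) * m)"
proof -
  obtain c where c: "\<And>x. complex_of_real (\<phi> x) = (\<Sum>j\<in>{-int J..int J}. c j * e1 (of_int j * x))"
    using tp by (auto simp: trig_poly_def)
  define Z where "Z = {-int J..int J} - {0}"
  define I where "I = P \<times> Z"
  define w where "w = (\<lambda>i::nat \<times> int. c (snd i))"
  define v where "v = (\<lambda>i::nat \<times> int. int (fst i) * snd i)"
  have Z: "{-int J..int J} = insert 0 Z" "finite Z" "0 \<notin> Z" by (auto simp: Z_def)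
  have finI: "finite I" using P Z by (simp add: I_def)
  have cphi: "continuous_on A \<phi>" for A
  proof -
    have "continuous_on A (\<lambda>x. Re (complex_of_real (\<phi> x)))"
      by (intro continuous_intros trig_poly_continuous_on[OF tp])
    then show ?thesis by simp
  qed
  have "complex_of_real m = (LINT x|unit_lborel. complex_of_real (\<phi> x))"
    unfolding m by (rule integral_complex_of_real[symmetric])
  also have "\<dots> = (\<Sum>j\<in>{-int J..int J}. LINT x|unit_lborel. c j * e1 (of_int j * x))"
    unfolding c by (intro Bochner_Integration.integral_sum integrable_unit_lborel continuous_intros)
  also have "\<dots> = (\<Sum>j\<in>{-int J..int J}. if j = 0 then c j else 0)"
    unfolding integral_mult_right_zero integral_e1 by (intro sum.cong) auto
  also have "\<dots> = c 0" by simp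
  \<comment> \<open>Subtracting the mean therefore removes exactly the term \<open>j = 0\<close>,
    which is why the index set is built on \<open>Z\<close>.\<close>
  finally have c0: "c 0 = complex_of_real m" ..
  have T: "complex_of_real ((\<Sum>p\<in>P. \<phi> (real p * x)) - real (card P) * m)
      = (\<Sum>i\<in>I. w i * e1 (of_int (v i) * x))" for x
  proof -
    have "complex_of_real (\<phi> (real p * x)) - of_real m = (\<Sum>j\<in>Z. c j * e1 (of_int (int p * j) * x))" for p
      unfolding c Z(1) using Z by (simp add: c0 mult_ac)
    then have "(\<Sum>p\<in>P. complex_of_real (\<phi> (real p * x)) - of_real m)
       = (\<Sum>p\<in>P. \<Sum>j\<in>Z. c j * e1 (of_int (int p * j) * x))" by simp
    also have "\<dots> = (\<Sum>i\<in>I. w i * e1 (of_int (v i) * x))"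
      unfolding I_def w_def v_def by (simp add: sum.cartesian_product case_prod_unfold)
    finally show ?thesis by (simp add: sum_subtractf)
  qed
  have "norm (\<Sum>i\<in>I. w i * e1 (of_int (v i) * x)) ^ 2
      = ((\<Sum>p\<in>P. \<phi> (real p * x)) - real (card P) * m)\<^sup>2" for x
    unfolding T[symmetric] norm_of_real by simp
  then have "(LINT x|unit_lborel. ((\<Sum>p\<in>P. \<phi> (real p * x)) - real (card P) * m)\<^sup>2)
      = (LINT x|unit_lborel. (norm (\<Sum>i\<in>I. w i * e1 (of_int (v i) * x)))\<^sup>2)" by simp
  also have "\<dots> \<le> log 2 (real J * real H) * (\<Sum>i\<in>I. (norm (w i))\<^sup>2)"
  proof (rule integral_norm_sq_e1_sum_le[OF finI])
    fix i assume i: "i \<in> I"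
    obtain p j where ij: "i = (p, j)" by (cases i)
    have pj: "p \<in> P" "j \<in> Z" using i by (auto simp: ij I_def)
    then have p: "prime p" "p \<le> H" using P by auto
    have j: "j \<noteq> 0" "\<bar>j\<bar> \<le> int J" using pj by (auto simp: Z_def)
    define n where "n = nat \<bar>v i\<bar>"
    have n: "n > 0" using prime_gt_0_nat[OF p(1)] j by (simp add: n_def v_def ij)
    have "card {k \<in> I. v k = v i} \<le> card {q. prime q \<and> q dvd n}"
    proof (rule card_inj_on_le[where f = fst])
      show "inj_on fst {k \<in> I. v k = v i}"
      proof (rule inj_onI)
        fix k l assume kl: "k \<in> {k \<in> I. v k = v i}" "l \<in> {k \<in> I. v k = v i}" "fst k = fst l"
        then have "prime (fst k)" using P(2) by (auto simp: I_def)
        then have "fst k \<noteq> 0" by auto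
        moreover have "int (fst k) * snd k = int (fst k) * snd l" using kl by (auto simp: v_def)
        ultimately show "k = l" using kl(3) by (simp add: prod_eq_iff)
      qed
      show "fst ` {k \<in> I. v k = v i} \<subseteq> {q. prime q \<and> q dvd n}"
      proof (clarsimp)
        fix q k assume k: "(q, k) \<in> I" "v (q, k) = v i"
        have "int q dvd v i" unfolding k(2)[symmetric] by (simp add: v_def)
        then have "q dvd n" unfolding n_def by (metis dvd_abs_iff int_dvd_int_iff abs_ge_zero nat_0_le)
        then show "prime q \<and> q dvd n" using k P(2) by (auto simp: I_def)
      qed
      show "finite {q. prime q \<and> q dvd n}" using n by (intro finite_subset[OF _ finite_atMost[of n]]) (auto dest: dvd_imp_le)
    qed
    then have "real (card {k \<in> I. v k = v i}) \<le> real (card {q. prime q \<and> q dvd n})" by simp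
    also have "\<dots> \<le> log 2 (real n)" by (rule card_prime_divisors_le_log[OF n])
    also have "\<dots> \<le> log 2 (real J * real H)"
    proof -
      have jJ: "real_of_int \<bar>j\<bar> \<le> real J" using j(2) by linarith
      have "real n = real p * real_of_int \<bar>j\<bar>" by (simp add: n_def v_def ij abs_mult)
      also have "\<dots> \<le> real H * real J"
        using p jJ by (intro mult_mono) simp_all
      finally show ?thesis using n by (simp add: mult.commute)
    qed
    finally show "real (card {k \<in> I. v k = v i}) \<le> log 2 (real J * real H)" .
  qed
  also have "\<dots> \<le> log 2 (real J * real H) * (real (card P) * m)"
  \<comment> \<open>For nonempty \<open>P\<close> the logarithm is nonnegative, so it may multiply
    the bound on the coefficients; for empty \<open>P\<close> both sides are 0.\<close>
  proof (cases "P = {}")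
    case False
    have "(\<Sum>i\<in>I. (norm (w i))\<^sup>2) = real (card P) * (\<Sum>j\<in>Z. (norm (c j))\<^sup>2)"
      unfolding I_def w_def using sum.cartesian_product[of "\<lambda>p j. (norm (c j))\<^sup>2" Z P]
      by (simp add: case_prod_unfold)
    also have "(\<Sum>j\<in>Z. (norm (c j))\<^sup>2) \<le> (\<Sum>j\<in>{-int J..int J}. (norm (c j))\<^sup>2)"
      by (rule sum_mono2) (auto simp: Z_def)
    also have "\<dots> = (LINT x|unit_lborel. (norm (\<Sum>j\<in>{-int J..int J}. c j * e1 (of_int j * x)))\<^sup>2)"
      by (rule parseval_e1_sum[symmetric]) auto
    also have "\<dots> = (LINT x|unit_lborel. (\<phi> x)\<^sup>2)"
      unfolding c[symmetric] norm_of_real by simp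
    also have "\<dots> \<le> m" unfolding m
    proof (intro integral_mono integrable_unit_lborel continuous_intros cphi)
      fix x show "(\<phi> x)\<^sup>2 \<le> \<phi> x" using bd[of x] by (simp add: power2_eq_square mult_left_le)
    qed
    finally have "(\<Sum>i\<in>I. (norm (w i))\<^sup>2) \<le> real (card P) * m" by (simp add: mult_left_mono)
    moreover have "log 2 (real J * real H) \<ge> 0"
    proof -
      obtain p where "p \<in> P" using False by auto
      then have "H \<ge> 1" using P(2) prime_ge_1_nat by (meson order.trans)
      then have "J * H \<ge> 1" using J by simp
      then have "real J * real H \<ge> 1" by (metis of_nat_1 of_nat_le_iff of_nat_mult)
      then show ?thesis by simp
    qed
    ultimately show ?thesis by (rule mult_left_mono)
  qed (simp add: I_def)
  finally show ?thesis .
qed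

text \<open>Chebyshev's inequality: \<open>E\<close> is the set where the sum over \<open>P\<close>
  deviates from its mean by at least half the mean, which produces the factor 4. Off
  \<open>E\<close> the average of \<open>\<phi> (p * x)\<close> over \<open>P\<close> exceeds
  \<open>m / 2\<close>, hence so does some term.\<close>

lemma prime_dilates_hit:
  fixes \<phi> :: "real \<Rightarrow> real" and P :: "nat set"
  assumes tp: "trig_poly J (\<lambda>x. complex_of_real (\<phi> x))" and J: "J > 0"
    and bd: "\<And>x. 0 \<le> \<phi> x \<and> \<phi> x \<le> 1"
    and P: "finite P" "P \<noteq> {}" "\<And>p. p \<in> P \<Longrightarrow> prime p \<and> p \<le> H"
    and m: "m = (LINT x|unit_lborel. \<phi> x)" "m > 0"
  shows "\<exists>E\<in>sets lborel. E \<subseteq> {0..1} \<and> measure lborel E \<le> 4 * log 2 (real J * real H) / (real (card P) * m) \<and>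
     (\<forall>x\<in>{0..1} - E. \<exists>p\<in>P. \<phi> (real p * x) > m / 2)"
proof -
  define T where "T x = ((\<Sum>p\<in>P. \<phi> (real p * x)) - real (card P) * m)\<^sup>2" for x
  define A where "A = real (card P) * m"
  have A: "A > 0" using P m by (simp add: A_def card_gt_0_iff)
  define E where "E = {x \<in> {0..1}. T x \<ge> (A / 2)\<^sup>2}"
  have cphi: "continuous_on B \<phi>" for B
  proof -
    have "continuous_on B (\<lambda>x. Re (complex_of_real (\<phi> x)))"
      by (intro continuous_intros trig_poly_continuous_on[OF tp])
    then show ?thesis by simp
  qed
  have cT: "continuous_on B T" for B
    unfolding T_def
    by (intro continuous_intros continuous_on_compose2[OF cphi[of UNIV]]) auto
  have "closed ({0..1} \<inter> T -` {(A / 2)\<^sup>2..})"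
    by (intro continuous_closed_preimage cT) auto
  also have "{0..1} \<inter> T -` {(A / 2)\<^sup>2..} = E" by (auto simp: E_def)
  finally have Es: "E \<in> sets lborel" by simp
  have "measure lborel E = measure unit_lborel E"
    by (subst measure_restrict_space) (auto simp: E_def)
  also have "\<dots> = measure unit_lborel {x \<in> space unit_lborel. (A / 2)\<^sup>2 \<le> T x}"
    by (simp add: E_def)
  also have "\<dots> \<le> (LINT x|unit_lborel. T x) / (A / 2)\<^sup>2"
  proof (rule integral_Markov_inequality_measure[where A = "{}"])
    show "integrable unit_lborel T" by (intro integrable_unit_lborel cT)
  qed (use A in \<open>auto simp: T_def\<close>)
  also have "\<dots> \<le> log 2 (real J * real H) * A / (A / 2)\<^sup>2"
    unfolding T_def A_def
    by (intro divide_right_mono variance_prime_dilates[OF tp J bd P(1) P(3) m(1)]) auto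
  also have "\<dots> = 4 * log 2 (real J * real H) / A"
    using A by (simp add: power2_eq_square field_simps)
  finally have meas: "measure lborel E \<le> 4 * log 2 (real J * real H) / A" .
  have "\<exists>p\<in>P. \<phi> (real p * x) > m / 2" if x: "x \<in> {0..1} - E" for x
  proof (rule ccontr)
    assume "\<not> ?thesis"
    then have "(\<Sum>p\<in>P. \<phi> (real p * x)) \<le> (\<Sum>p\<in>P. m / 2)"
      by (intro sum_mono) (auto simp: not_less)
    then have "A / 2 \<le> A - (\<Sum>p\<in>P. \<phi> (real p * x))" by (simp add: A_def mult_ac)
    then have "(A / 2)\<^sup>2 \<le> (A - (\<Sum>p\<in>P. \<phi> (real p * x)))\<^sup>2"
      using A by (intro power_mono) auto
    also have "\<dots> = T x" unfolding T_def A_def by (rule power2_commute)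
    finally show False using x by (auto simp: E_def)
  qed
  moreover have "E \<subseteq> {0..1}" by (auto simp: E_def)
  ultimately show ?thesis using Es meas unfolding A_def by blast
qed

section \<open>Large values of the exponential sum\<close>

text \<open>If \<open>2 ^ j\<close> is the largest power of two not exceeding \<open>y\<close>, the
  sum is the geometric sum \<open>2 ^ (j + 1) - 1\<close>; if \<open>y < 1\<close> the sum is empty
  and the leading 1 suffices.\<close>

lemma le_sum_dyadic_levels:
  fixes y :: real
  assumes "y < 2 ^ Suc n"
  shows "y \<le> 1 + (\<Sum>k\<le>n. if 2 ^ k \<le> y then 2 ^ k else 0)"
  using assms
proof (induction n)
  case 0
  have "(\<Sum>k\<le>0::nat. if 2 ^ k \<le> y then 2 ^ k else 0 :: real) = (if 1 \<le> y then 1 else 0)"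
    by (subst atMost_0) simp
  then show ?case using 0 by simp
next
  case (Suc n)
  show ?case
  proof (cases "2 ^ Suc n \<le> y")
    case True
    have "2 ^ k \<le> y" if "k \<le> Suc n" for k
      using power_increasing[OF that, of "2::real"] True by simp
    then have "(\<Sum>k\<le>Suc n. if 2 ^ k \<le> y then 2 ^ k else 0 :: real) = (\<Sum>k\<le>Suc n. 2 ^ k)"
      by (intro sum.cong) auto
    also have "\<dots> = 2 ^ Suc (Suc n) - 1"
      using sum_gp_basic[of "2::real" "Suc n"] by simp
    finally show ?thesis using Suc.prems by simp
  next
    case False
    then show ?thesis using Suc.IH by simp
  qed
qed

text \<open>Integrate the dyadic bound for \<open>f\<close>. Since \<open>I \<ge> 2\<close>, the
  constant 1 costs at most half of \<open>I\<close>, and one of the at most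
  \<open>log 2 N + 1\<close> levels carries an average share of the rest.\<close>

lemma exists_dyadic_level:
  fixes f :: "real \<Rightarrow> real" and N :: nat
  assumes cont: "continuous_on {0..1} f" and N: "N \<ge> 1" and ub: "\<And>x. f x \<le> real N"
    and I: "I = (LINT x|unit_lborel. f x)" "I \<ge> 2"
  shows "\<exists>k. 2 ^ k \<le> N \<and> I / (2 * (log 2 (real N) + 1)) \<le> 2 ^ k * measure unit_lborel {x\<in>{0..1}. f x \<ge> 2 ^ k}"
proof -
  interpret finite_measure unit_lborel by (rule finite_measure_unit_lborel)
  define n where "n = nat \<lfloor>log 2 (real N)\<rfloor>"
  have lg: "log 2 (real N) \<ge> 0" using N by simp
  have n1: "real n \<le> log 2 (real N)" "log 2 (real N) < real n + 1"
    using lg unfolding n_def by linarith+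
  have "2 powr real n \<le> real N" using n1 N by (simp add: le_log_iff)
  then have n2: "2 ^ n \<le> N" by (simp add: powr_realpow)
  have "real N < 2 powr (real n + 1)" using n1 N by (simp add: log_less_iff)
  then have n3: "real N < 2 ^ Suc n" by (simp add: powr_realpow powr_add)
  define E where "E k = {x\<in>{0..1}. f x \<ge> 2 ^ k}" for k :: nat
  have E: "E k \<in> sets unit_lborel" for k
  proof -
    have "closed ({0..1} \<inter> f -` {2 ^ k..})"
      by (intro continuous_closed_preimage cont) auto
    also have "{0..1} \<inter> f -` {2 ^ k..} = E k" by (auto simp: E_def)
    finally show ?thesis by (subst sets_restrict_space_iff) (auto simp: E_def)
  qed
  have fin: "emeasure unit_lborel (E k) < \<infinity>" for k
    unfolding infinity_ennreal_def by (rule top.not_eq_extremum[THEN iffD1, OF emeasure_finite])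
  have "I \<le> (LINT x|unit_lborel. 1 + (\<Sum>k\<le>n. 2 ^ k * indicator (E k) x))"
    unfolding I
  proof (rule integral_mono)
    show "integrable unit_lborel f" by (intro integrable_unit_lborel cont)
    show "integrable unit_lborel (\<lambda>x. 1 + (\<Sum>k\<le>n. 2 ^ k * indicator (E k) x :: real))"
      by (intro Bochner_Integration.integrable_add Bochner_Integration.integrable_sum
          integrable_mult_right integrable_real_indicator E fin) simp
    fix x assume x: "x \<in> space unit_lborel"
    have "f x < 2 ^ Suc n" using ub[of x] n3 by linarith
    then have "f x \<le> 1 + (\<Sum>k\<le>n. if 2 ^ k \<le> f x then 2 ^ k else 0)"
      by (rule le_sum_dyadic_levels)
    also have "(\<Sum>k\<le>n. if 2 ^ k \<le> f x then 2 ^ k else 0 :: real) = (\<Sum>k\<le>n. 2 ^ k * indicator (E k) x)"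
      using x by (intro sum.cong) (auto simp: E_def indicator_def)
    finally show "f x \<le> 1 + (\<Sum>k\<le>n. 2 ^ k * indicator (E k) x)" .
  qed
  also have "\<dots> = 1 + (\<Sum>k\<le>n. 2 ^ k * measure unit_lborel (E k))"
  proof -
    have int: "integrable unit_lborel (\<lambda>x. 2 ^ k * indicator (E k) x :: real)" for k
      by (intro integrable_mult_right integrable_real_indicator E fin)
    have "(LINT x|unit_lborel. 1 + (\<Sum>k\<le>n. 2 ^ k * indicator (E k) x))
       = (LINT x|unit_lborel. 1) + (\<Sum>k\<le>n. LINT x|unit_lborel. 2 ^ k * indicator (E k) x :: real)"
    proof -
      have "integrable unit_lborel (\<lambda>x. 1 :: real)"
        by (intro integrable_unit_lborel continuous_intros)
      then show ?thesis
        by (simp only: Bochner_Integration.integral_add Bochner_Integration.integral_sum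
            Bochner_Integration.integrable_sum int)
    qed
    moreover have "E k \<inter> space unit_lborel = E k" for k by (auto simp: E_def)
    ultimately show ?thesis
      using measure_unit_lborel_space by (simp only: integral_mult_right_zero integral_indicator) simp
  qed
  finally have up: "I \<le> 1 + (\<Sum>k\<le>n. 2 ^ k * measure unit_lborel (E k))" .
  have "\<exists>k\<le>n. I / (2 * (real n + 1)) \<le> 2 ^ k * measure unit_lborel (E k)"
  proof (rule ccontr)
    assume "\<not> ?thesis"
    then have "(\<Sum>k\<le>n. 2 ^ k * measure unit_lborel (E k)) < (\<Sum>k\<le>n. I / (2 * (real n + 1)))"
      by (intro sum_strict_mono) (auto simp: not_le[symmetric])
    also have "\<dots> = I / 2" by (simp add: field_simps)
    finally show False using up I by linarith
  qed
  then obtain k where k: "k \<le> n" "I / (2 * (real n + 1)) \<le> 2 ^ k * measure unit_lborel (E k)" by blast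
  have "I / (2 * (log 2 (real N) + 1)) \<le> I / (2 * (real n + 1))"
    using I n1 by (intro divide_left_mono) auto
  moreover have "2 ^ k \<le> N" using k(1) n2 power_increasing[of k n "2::nat"] by linarith
  ultimately show ?thesis using k unfolding E_def by (intro exI[of _ k]) linarith
qed

text \<open>\<open>1 - (1 - z) ^ d\<close> is a polynomial substitute for the indicator of
  \<open>z \<ge> 1/d\<close>: Bernoulli's inequality makes it small below the threshold, and
  \<open>exp (-1) \<le> 1/2\<close> keeps it at least \<open>1/2\<close> above.\<close>

lemma smooth_threshold_bounds:
  fixes z :: real
  assumes "0 \<le> z" "z \<le> 1"
  shows "0 \<le> 1 - (1 - z) ^ d" "1 - (1 - z) ^ d \<le> 1" "1 - (1 - z) ^ d \<le> real d * z"
    "real d * z \<ge> 1 \<Longrightarrow> 1 - (1 - z) ^ d \<ge> 1 / 2"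
proof -
  show "0 \<le> 1 - (1 - z) ^ d" using assms by (simp add: power_le_one)
  show "1 - (1 - z) ^ d \<le> 1" using assms by simp
  show "1 - (1 - z) ^ d \<le> real d * z"
    using Bernoulli_inequality[of "- z" d] assms by simp
  assume dz: "real d * z \<ge> 1"
  have "(1 - z) ^ d \<le> exp (- z) ^ d"
    using exp_ge_add_one_self[of "- z"] assms by (intro power_mono) auto
  also have "\<dots> = exp (- (real d * z))" by (simp add: exp_of_nat_mult[symmetric])
  also have "\<dots> \<le> exp (- 1)" using dz by simp
  also have "\<dots> \<le> 1 / 2"
    using exp_ge_add_one_self[of 1] by (simp add: exp_minus field_simps)
  finally show "1 - (1 - z) ^ d \<ge> 1 / 2" by simp
qed

text \<open>
  In the estimate below, \<open>\<phi> > m/2\<close> only forces \<open>|S| \<ge> y (m/4)\<^bsup>1/(2r)\<^esup>\<close>, since \<open>\<phi>\<close> does not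
  vanish below the level \<open>y\<close>; this is the source of the factor \<open>N\<^bsup>-5/(2r)\<^esup>\<close>.
\<close>

lemma discrepancy_large_off_small_set:
  fixes a :: "nat \<Rightarrow> int" and N K r :: nat and X :: real
  defines "S \<equiv> (\<lambda>x. \<Sum>n=1..N. e1 (of_int (a n) * x))"
  assumes N: "N \<ge> 2" and K: "\<And>n. n \<in> {1..N} \<Longrightarrow> \<bar>a n\<bar> \<le> int K" "K \<ge> 1" and r: "r \<ge> 1"
    and X: "2 \<le> X" "X \<le> real N"
    and I: "I = (LINT x|unit_lborel. norm (S x))" "I \<ge> 2"
  shows "\<exists>E\<in>sets lborel. E \<subseteq> {0..1} \<and>
     measure lborel E \<le> 60 * ln (real N) * log 2 (4 * real r * real K * real N ^ (2 * r + 5)) / X \<and>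
     (\<forall>x\<in>{0..1} - E. real N * discrepancy (\<lambda>n. frac (of_int (a n) * x)) N
        \<ge> I / (16 * pi * (log 2 (real N) + 1) * X) * real N powr (- 5 / (2 * r)))"
proof -
  define Lg where "Lg = log 2 (real N) + 1"
  have Lg1: "Lg \<ge> 1" using N by (simp add: Lg_def)
  have LgN: "Lg \<le> real N"
  proof -
    have "N \<le> 2 ^ (N - 1)" using less_exp[of "N - 1"] N by linarith
    then have "real N \<le> 2 ^ (N - 1)" by (metis of_nat_le_iff of_nat_numeral of_nat_power)
    then have "log 2 (real N) \<le> log 2 (2 ^ (N - 1))" using N by (subst log_le_cancel_iff) auto
    also have "\<dots> = real N - 1" using N by (simp add: log_nat_power of_nat_diff)
    finally show ?thesis by (simp add: Lg_def)
  qed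
  have tpS: "trig_poly K S"
    unfolding S_def by (intro trig_poly_sum trig_poly_e1 K)
  have cS: "continuous_on A (\<lambda>x. norm (S x))" for A
    by (intro continuous_intros trig_poly_continuous_on[OF tpS])
  have SN: "norm (S x) \<le> real N" for x
    unfolding S_def using sum_norm_le[of "{1..N}" "\<lambda>n. e1 (of_int (a n) * x)" "\<lambda>_. 1"] by simp
  obtain k where k: "2 ^ k \<le> N" "I / (2 * Lg) \<le> 2 ^ k * measure unit_lborel {x\<in>{0..1}. norm (S x) \<ge> 2 ^ k}"
    using exists_dyadic_level[OF cS _ SN I(1) I(2)] N unfolding Lg_def by auto
  define y where "y = (2::real) ^ k"
  define M where "M = {x\<in>{0..1}. norm (S x) \<ge> y}"
  have "real (2 ^ k) \<le> real N" using k(1) by (simp only: of_nat_le_iff)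
  then have y: "1 \<le> y" "y \<le> real N" by (simp_all add: y_def)
  have yM: "I / (2 * Lg) \<le> y * measure unit_lborel M" using k(2) by (simp add: y_def M_def)
  \<comment> \<open>Chosen so that \<open>d * z x \<ge> 1\<close> wherever
    \<open>norm (S x) \<ge> y\<close>. Rounding up at most doubles the value because
    \<open>N / y \<ge> 1\<close>.\<close>
  define d where "d = nat \<lceil>(real N / y) ^ (2 * r)\<rceil>"
  have Ny: "(real N / y) ^ (2 * r) \<ge> 1" using y by (intro one_le_power) auto
  have d: "(real N / y) ^ (2 * r) \<le> real d" "real d \<le> 2 * (real N / y) ^ (2 * r)"
    unfolding d_def using Ny by linarith+
  \<comment> \<open>An even power of the norm is needed: \<open>S x * cnj (S x)\<close> is a
    trigonometric polynomial of degree \<open>2 * K\<close>, which explains the degree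
    \<open>J\<close>.\<close>
  define z where "z x = ((norm (S x) / real N)\<^sup>2) ^ r" for x
  have z: "0 \<le> z x" "z x \<le> 1" for x
    using SN[of x] N by (auto simp: z_def power_le_one)
  define \<phi> where "\<phi> x = 1 - (1 - z x) ^ d" for x
  define J where "J = d * (r * (K + K))"
  have J: "J > 0"
  proof -
    have "real d > 0" using d Ny by linarith
    then show ?thesis using K r by (simp add: J_def)
  qed
  have bd: "0 \<le> \<phi> x \<and> \<phi> x \<le> 1" for x
    unfolding \<phi>_def using smooth_threshold_bounds(1,2)[OF z] by blast
  have tp: "trig_poly J (\<lambda>x. complex_of_real (\<phi> x))"
  proof -
    have "complex_of_real (\<phi> x) = 1 - (1 - (inverse (real N ^ 2) * (S x * cnj (S x))) ^ r) ^ d" for x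
      by (simp add: \<phi>_def z_def power_divide complex_norm_square[symmetric] field_simps)
    moreover have "trig_poly J (\<lambda>x. 1 - (1 - (inverse (real N ^ 2) * (S x * cnj (S x))) ^ r) ^ d)"
      unfolding J_def
      by (intro trig_poly_diff trig_poly_power trig_poly_const trig_poly_const_mult
          trig_poly_mult trig_poly_cnj tpS)
    ultimately show ?thesis by simp
  qed
  have cphi: "continuous_on A \<phi>" for A
    unfolding \<phi>_def z_def using N by (intro continuous_intros cS) auto
  define m where "m = (LINT x|unit_lborel. \<phi> x)"
  have Ms: "M \<in> sets unit_lborel"
  proof -
    have "closed ({0..1} \<inter> (\<lambda>x. norm (S x)) -` {y..})"
      by (intro continuous_closed_preimage cS) auto
    also have "{0..1} \<inter> (\<lambda>x. norm (S x)) -` {y..} = M" by (auto simp: M_def)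
    finally show ?thesis by (subst sets_restrict_space_iff) (auto simp: M_def)
  qed
  interpret finite_measure unit_lborel by (rule finite_measure_unit_lborel)
  have finM: "emeasure unit_lborel M < \<infinity>"
    unfolding infinity_ennreal_def by (rule top.not_eq_extremum[THEN iffD1, OF emeasure_finite])
  have "measure unit_lborel M / 2 = (LINT x|unit_lborel. (1 / 2) * indicator M x)"
  proof -
    have "M \<inter> space unit_lborel = M" by (auto simp: M_def)
    then show ?thesis by (simp only: integral_mult_right_zero integral_indicator) simp
  qed
  also have "\<dots> \<le> m"
    unfolding m_def
  proof (rule integral_mono)
    show "integrable unit_lborel (\<lambda>x. (1 / 2) * indicator M x :: real)"
      by (intro integrable_mult_right integrable_real_indicator Ms finM)
    show "integrable unit_lborel \<phi>" by (intro integrable_unit_lborel cphi)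
    fix x
    show "(1 / 2) * indicator M x \<le> \<phi> x"
    proof (cases "x \<in> M")
      case True
      have "1 = (real N / y) ^ (2 * r) * ((y / real N)\<^sup>2) ^ r"
        using y N by (simp add: power_mult[symmetric] power_mult_distrib[symmetric])
      also have "\<dots> \<le> real d * z x"
        unfolding z_def using d y True by (intro mult_mono power_mono divide_right_mono) (auto simp: M_def)
      finally have "\<phi> x \<ge> 1 / 2" unfolding \<phi>_def by (intro smooth_threshold_bounds(4) z)
      then show ?thesis using True by simp
    qed (use bd in simp)
  qed
  finally have mM: "measure unit_lborel M / 2 \<le> m" .
  \<comment> \<open>Half of the pigeonhole bound: \<open>\<phi>\<close> is only known to be at least
    \<open>1/2\<close> on \<open>M\<close>, so \<open>m\<close> is at least half the measure of
    \<open>M\<close>.\<close>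
  define q where "q = I / (4 * Lg)"
  have q: "q \<ge> 1 / (2 * Lg)" "q > 0" using I Lg1 by (simp_all add: q_def field_simps)
  have ym: "q \<le> y * m"
  proof -
    have "q \<le> y * (measure unit_lborel M / 2)" using yM by (simp add: q_def field_simps)
    also have "\<dots> \<le> y * m" using mM y by (intro mult_left_mono) auto
    finally show ?thesis .
  qed
  have m0: "m > 0" using ym q y by (smt (verit) mult_nonneg_nonpos)
  have m1: "m \<le> 1"
  proof -
    have "m \<le> (LINT x|unit_lborel. 1)"
      unfolding m_def using bd by (intro integral_mono integrable_unit_lborel cphi continuous_intros) auto
    then show ?thesis using measure_unit_lborel_space by simp
  qed
  \<comment> \<open>A crude polynomial lower bound for \<open>m\<close>, used twice: to keep
    \<open>H\<close> polynomial in \<open>N\<close>, and to make the loss \<open>(m/4)\<close> to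
    the power \<open>1/(2r)\<close> a small power of \<open>N\<close>.\<close>
  have mlow: "m \<ge> 1 / (2 * real N ^ 2)"
  proof -
    have "1 / (2 * real N) \<le> 1 / (2 * Lg)" using LgN Lg1 by (intro divide_left_mono) auto
    also have "\<dots> \<le> real N * m" using q ym y m0 mult_right_mono[of y "real N" m] by linarith
    finally show ?thesis using N by (simp add: field_simps power2_eq_square)
  qed
  have N2: "real N \<ge> 2" using N by simp
  have pow: "2 ^ j * real N ^ i \<le> real N ^ (j + i)" for i j
    unfolding power_add using N2 by (intro mult_right_mono power_mono) auto
  \<comment> \<open>With about \<open>H / ln H\<close> primes, the expected number of hits
    \<open>card P * m\<close> is at least \<open>X / (3 * ln H)\<close>. Thus \<open>X\<close> is
    the margin that makes the exceptional set small, and the same factor is lost in the final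
    bound.\<close>
  define H where "H = nat \<lceil>X / m\<rceil>"
  have Xm: "X / m \<ge> 2" using X m0 m1 by (simp add: field_simps)
  have H: "X / m \<le> real H" "real H \<le> 2 * X / m"
    unfolding H_def using Xm by linarith+
  have H2: "H \<ge> 2" using H Xm by linarith
  have HN: "real H \<le> real N ^ 5"
  proof -
    have "1 / m \<le> 2 * real N ^ 2" using mlow m0 N by (simp add: field_simps)
    then have "2 * X * (1 / m) \<le> 2 * real N * (2 * real N ^ 2)"
      using X m0 by (intro mult_mono) auto
    then have "real H \<le> 2 ^ 2 * real N ^ 3" using H(2) by (simp add: power2_eq_square power3_eq_cube)
    also have "\<dots> \<le> real N ^ (2 + 3)" by (rule pow)
    finally show ?thesis by simp
  qed
  define P where "P = {p. prime p \<and> p \<le> H}"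
  have "2 \<in> P" using H2 by (simp add: P_def)
  then have P: "P \<noteq> {}" "finite P" "\<And>p. p \<in> P \<Longrightarrow> prime p \<and> p \<le> H"
    by (blast, simp_all add: P_def)
  obtain E where E: "E \<in> sets lborel" "E \<subseteq> {0..1}"
      "measure lborel E \<le> 4 * log 2 (real J * real H) / (real (card P) * m)"
      "\<And>x. x \<in> {0..1} - E \<Longrightarrow> \<exists>p\<in>P. \<phi> (real p * x) > m / 2"
    using prime_dilates_hit[OF tp J bd P(2,1,3) m_def m0] by blast
  have "real J * real H \<le> (2 * real N ^ (2 * r)) * (real r * (2 * real K)) * real N ^ 5"
  proof -
    have "(real N / y) ^ (2 * r) \<le> real N ^ (2 * r)"
      using y by (intro power_mono) (auto simp: field_simps)
    then have "real d \<le> 2 * real N ^ (2 * r)" using d by linarith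
    then have "real J \<le> (2 * real N ^ (2 * r)) * (real r * (2 * real K))"
      unfolding J_def of_nat_mult of_nat_add by (intro mult_mono) auto
    then show ?thesis using HN by (intro mult_mono) auto
  qed
  also have "\<dots> = 4 * real r * real K * real N ^ (2 * r + 5)" by (simp add: power_add)
  finally have JH: "real J * real H \<le> 4 * real r * real K * real N ^ (2 * r + 5)" .
  have JH1: "real J * real H \<ge> 1"
  proof -
    have "J * H \<ge> 1" using J H2 by simp
    then show ?thesis by (metis of_nat_1 of_nat_le_iff of_nat_mult)
  qed
  define W where "W = log 2 (4 * real r * real K * real N ^ (2 * r + 5))"
  have W: "log 2 (real J * real H) \<le> W" "0 \<le> log 2 (real J * real H)"
    unfolding W_def by (rule log_mono) (use JH JH1 in auto)
  have lnH: "ln (real H) > 0" "ln (real H) \<le> 5 * ln (real N)"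
  proof -
    have "ln (real H) \<le> ln (real N ^ 5)" using HN H2 N by (subst ln_le_cancel_iff) auto
    then show "ln (real H) \<le> 5 * ln (real N)" using N by (simp add: ln_realpow)
  qed (use H2 in simp)
  have Pm: "real (card P) * m \<ge> X / (3 * ln (real H))"
  proof -
    have "X / (3 * m) \<le> real H / 3" using H by (simp add: field_simps)
    also have "\<dots> \<le> real (card P) * ln (real H)" unfolding P_def by (rule card_primes_ge[OF H2])
    finally show ?thesis using m0 lnH by (simp add: field_simps)
  qed
  have "measure lborel E \<le> 4 * log 2 (real J * real H) / (real (card P) * m)" by fact
  also have "\<dots> \<le> 4 * W / (X / (3 * ln (real H)))"
    using Pm W lnH X by (intro frac_le) auto
  also have "\<dots> = 12 * W * ln (real H) / X" by simp
  also have "\<dots> \<le> 12 * W * (5 * ln (real N)) / X"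
    using W lnH X by (intro divide_right_mono mult_left_mono) auto
  finally have meas: "measure lborel E \<le> 60 * ln (real N) * W / X" by (simp add: mult_ac)
  have "I / (16 * pi * Lg * X) * real N powr (- 5 / (2 * r))
       \<le> real N * discrepancy (\<lambda>n. frac (of_int (a n) * x)) N" if x: "x \<in> {0..1} - E" for x
  proof -
    obtain p where p: "p \<in> P" "\<phi> (real p * x) > m / 2" using E(4)[OF x] by blast
    have p0: "p > 0" "p \<le> H" using p(1) P(3) prime_gt_0_nat by auto
    define s where "s = norm (S (real p * x))"
    define D where "D = real N * discrepancy (\<lambda>n. frac (of_int (a n) * x)) N"
    define g where "g = real N powr (- 5 / (2 * r))"
    \<comment> \<open>The linear upper bound for the threshold polynomial converts
      \<open>\<phi> (p * x) > m/2\<close> back into a lower bound for \<open>s / y\<close>.\<close>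
    have "m / 2 \<le> real d * z (real p * x)"
      using p(2) smooth_threshold_bounds(3)[OF z, where d = d] unfolding \<phi>_def by (meson less_imp_le order_less_le_trans)
    also have "\<dots> \<le> 2 * (real N / y) ^ (2 * r) * z (real p * x)"
      using d z by (intro mult_right_mono) auto
    also have "\<dots> = 2 * (s / y) ^ (2 * r)"
      using N y by (simp add: z_def s_def power_mult[symmetric] power_divide)
    finally have sy: "m / 4 \<le> (s / y) ^ (2 * r)" by simp
    \<comment> \<open>The exponent 5 comes from \<open>m / 4 \<ge> 1 / (8 * N\<^sup>2)\<close> and
      \<open>8 * N\<^sup>2 \<le> N ^ 5\<close> for \<open>N \<ge> 2\<close>.\<close>
    have "g ^ (2 * r) = real N powr (- 5)"
      using r N by (simp add: g_def powr_power)
    also have "\<dots> = 1 / real N ^ 5" using N by (simp add: powr_minus powr_numeral divide_inverse)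
    also have "\<dots> \<le> 1 / (2 ^ 3 * real N ^ 2)"
      using pow[of 3 2] N by (intro divide_left_mono) auto
    also have "\<dots> \<le> m / 4" using mlow by simp
    finally have "g ^ (2 * r) \<le> (s / y) ^ (2 * r)" using sy by linarith
    then have "g \<le> s / y" using r y by (subst (asm) power_mono_iff) (auto simp: g_def s_def)
    then have gs: "g * y \<le> s" using y by (simp add: field_simps)
    \<comment> \<open>Since \<open>p\<close> is an integer, the value of \<open>S\<close> at the
      dilate \<open>p * x\<close> is the \<open>p\<close>-th harmonic sum of the fractional parts at
      \<open>x\<close>, so Koksma's inequality applies with \<open>h = p\<close>.\<close>
    have "e1 (real p * frac (real_of_int (a n) * x)) = e1 (of_int (a n) * (real p * x))" for n
      using e1_int_frac[of "int p" "real_of_int (a n) * x"] by (simp add: mult_ac)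
    then have "s = norm (\<Sum>n=1..N. e1 (real p * frac (real_of_int (a n) * x)))"
      unfolding s_def S_def by simp
    also have "\<dots> \<le> 2 * pi * p * D"
      unfolding D_def using N p0 by (intro norm_sum_e1_le_discrepancy) (auto simp: frac_lt_1)
    finally have sD: "s \<le> 2 * pi * p * D" .
    have "s \<ge> 0" by (simp add: s_def)
    \<comment> \<open>Nonnegativity allows \<open>p\<close> to be replaced by its upper bound
      \<open>2 * X / m\<close> below; it follows from \<open>sD\<close> itself.\<close>
    have D0: "D \<ge> 0"
    proof (rule ccontr)
      assume "\<not> D \<ge> 0"
      then have "2 * pi * p * D < 0" using p0 by (intro mult_pos_neg) auto
      then show False using sD \<open>s \<ge> 0\<close> by linarith
    qed
    have "2 * pi * p * D \<le> 2 * pi * (2 * X / m) * D"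
      using p0 H D0 by (intro mult_right_mono mult_left_mono) auto
    then have "g * y \<le> 4 * pi * X / m * D" using gs sD by simp
    then have "g * (y * m) \<le> 4 * pi * X * D" using m0 by (simp add: field_simps)
    moreover have "g * q \<le> g * (y * m)" using ym by (intro mult_left_mono) (auto simp: g_def)
    ultimately have "g * q \<le> 4 * pi * X * D" by linarith
    then have "g * q / (4 * pi * X) \<le> D" using X by (simp add: field_simps)
    then show ?thesis unfolding D_def g_def q_def by (simp add: mult_ac)
  qed
  then show ?thesis using E(1,2) meas unfolding W_def Lg_def by blast
qed

section \<open>Almost everywhere lower bounds\<close>

text \<open>Powers absorb logarithms. The three bounds serve, in order, the measure of the
  exceptional sets, the logarithmic loss from pigeonholing, and the side conditions
  \<open>X \<ge> 2\<close> and \<open>I \<ge> 2\<close>.\<close>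

lemma eventually_log_powr_bounds:
  fixes c \<delta> :: real and s :: nat
  assumes "c > 0" "\<delta> > 0"
  shows "\<forall>\<^sub>F x::real in at_top. 60 * ln x * log 2 (c * x ^ s) / x powr \<delta> \<le> x powr (- \<delta> / 2)"
    and "\<forall>\<^sub>F x::real in at_top. 16 * pi * (log 2 x + 1) < x powr \<delta>"
    and "\<forall>\<^sub>F x::real in at_top. 2 \<le> x powr \<delta>"
proof -
  have "\<forall>\<^sub>F x::real in at_top. 60 * ln x * ((ln c + real s * ln x) / ln 2) / x powr \<delta> \<le> x powr (- \<delta> / 2)"
    using assms by real_asymp
  then show "\<forall>\<^sub>F x::real in at_top. 60 * ln x * log 2 (c * x ^ s) / x powr \<delta> \<le> x powr (- \<delta> / 2)"
    using eventually_gt_at_top[of 0]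
  proof eventually_elim
    case (elim x)
    then show ?case using assms by (simp add: log_def ln_mult ln_realpow)
  qed
  have "\<forall>\<^sub>F x::real in at_top. 16 * pi * (ln x / ln 2 + 1) < x powr \<delta>"
    using assms by real_asymp
  then show "\<forall>\<^sub>F x::real in at_top. 16 * pi * (log 2 x + 1) < x powr \<delta>" by (simp add: log_def)
  show "\<forall>\<^sub>F x::real in at_top. 2 \<le> x powr \<delta>" using assms by real_asymp
qed

text \<open>The finitely many terms before the growth bound sets in are absorbed into
  \<open>C\<close>. The result bounds the degree of the exponential sum over all of
  \<open>{1..N}\<close>.\<close>

lemma polynomial_growth_uniform:
  fixes a :: "nat \<Rightarrow> int"
  assumes "\<forall>\<^sub>F n in sequentially. \<bar>real_of_int (a n)\<bar> \<le> real n ^ t"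
  obtains C :: nat where "C \<ge> 1" "\<And>n N. n \<in> {1..N} \<Longrightarrow> \<bar>a n\<bar> \<le> int (C * N ^ t)"
proof -
  obtain n0 where n0: "\<And>n. n \<ge> n0 \<Longrightarrow> \<bar>real_of_int (a n)\<bar> \<le> real n ^ t"
    using assms by (auto simp: eventually_sequentially)
  define C where "C = Suc (\<Sum>n<n0. nat \<bar>a n\<bar>)"
  have "\<bar>a n\<bar> \<le> int (C * N ^ t)" if n: "n \<in> {1..N}" for n N
  proof -
    have pw: "n ^ t \<le> N ^ t" "1 \<le> n ^ t" using n by (auto intro: power_mono)
    have "nat \<bar>a n\<bar> \<le> C * N ^ t"
    proof (cases "n < n0")
      case True
      have "nat \<bar>a n\<bar> \<le> (\<Sum>n<n0. nat \<bar>a n\<bar>)" using True by (intro member_le_sum) auto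
      also have "\<dots> \<le> C * 1" by (simp add: C_def)
      also have "\<dots> \<le> C * N ^ t" using pw by (intro mult_left_mono) auto
      finally show ?thesis .
    next
      case False
      then have "real_of_int \<bar>a n\<bar> \<le> real_of_int (int (n ^ t))" using n0[of n] by simp
      then have "\<bar>a n\<bar> \<le> int (n ^ t)" by (simp only: of_int_le_iff)
      then have "nat \<bar>a n\<bar> \<le> 1 * n ^ t" by (simp only: nat_le_iff mult_1)
      also have "\<dots> \<le> C * N ^ t" using pw by (intro mult_mono) (auto simp: C_def)
      finally show ?thesis .
    qed
    then show ?thesis by linarith
  qed
  then show ?thesis using that[of C] by (simp add: C_def)
qed

theorem theorem3:
  fixes a :: "nat \<Rightarrow> int" and t :: nat and \<tau> B' B :: real and BL :: "nat \<Rightarrow> nat"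
  assumes growth: "\<forall>\<^sub>F n in sequentially. \<bar>real_of_int (a n)\<bar> \<le> real n ^ t"
    and tau: "0 < \<tau>" "\<tau> < 1"
    and BB: "1 < B'" "B' < B"
    and BL_mono: "\<And>L M. 1 \<le> L \<Longrightarrow> L < M \<Longrightarrow> BL L < BL M"
    and BL_pos: "\<And>L. 1 \<le> L \<Longrightarrow> 0 < BL L"
    and BL_bounds: "\<And>L. 1 \<le> L \<Longrightarrow> B' ^ L \<le> real (BL L) \<and> real (BL L) \<le> B ^ L"
    and integral_bound: "\<And>\<epsilon>. \<epsilon> > 0 \<Longrightarrow> \<forall>\<^sub>F L in sequentially.
        (LINT \<alpha>:{0..1}|lborel.
           norm (\<Sum>n=1..BL L. exp (2 * pi * \<i> * complex_of_real (real_of_int (a n) * \<alpha>))))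
          > real (BL L) powr (\<tau> - \<epsilon>)"
  shows "AE \<alpha> in lborel. \<alpha> \<in> {0..<1} \<longrightarrow>
           (\<forall>\<epsilon>>0. \<exists>\<^sub>F N in sequentially.
              real N * discrepancy (\<lambda>n. frac (real_of_int (a n) * \<alpha>)) N > real N powr (\<tau> - \<epsilon>))"
proof -
  define D where "D \<alpha> N = real N * discrepancy (\<lambda>n. frac (real_of_int (a n) * \<alpha>)) N" for \<alpha> N
  define S where "S N x = (\<Sum>n=1..N. e1 (of_int (a n) * x))" for N x
  obtain C where C: "C \<ge> 1" "\<And>n N. n \<in> {1..N} \<Longrightarrow> \<bar>a n\<bar> \<le> int (C * N ^ t)"
    using polynomial_growth_uniform[OF growth] by metis
  have B'_lim: "filterlim (\<lambda>L. B' ^ L) at_top sequentially"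
    using BB(1) by real_asymp
  have BL_lim: "filterlim (\<lambda>L. real (BL L)) at_top sequentially"
    by (rule filterlim_at_top_mono[OF B'_lim])
       (use BL_bounds in \<open>auto intro!: eventually_mono[OF eventually_ge_at_top[of 1]]\<close>)
  have BL_lim_nat: "filterlim BL sequentially sequentially"
    using BL_lim by (simp add: filterlim_sequentially_iff_filterlim_real)
  \<comment> \<open>For a fixed \<epsilon> more holds than is asked: the bound is valid at
    \<open>N = BL L\<close> for all large \<open>L\<close>.\<close>
  have main: "AE \<alpha> in lborel. \<alpha> \<in> {0..1} \<longrightarrow> (\<forall>\<^sub>F L in sequentially. D \<alpha> (BL L) > real (BL L) powr (\<tau> - \<epsilon>))"
    if eps: "0 < \<epsilon>" "\<epsilon> < \<tau>" for \<epsilon>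
  proof -
    \<comment> \<open>Four losses of \<open>N powr \<delta>\<close> are budgeted: the integral
      hypothesis, the logarithmic factor, \<open>X = N powr \<delta>\<close>, and
      \<open>N powr (-5/(2r))\<close>, which the choice of \<open>r\<close> makes at least
      \<open>N powr (-\<delta>)\<close>.\<close>
    define \<delta> where "\<delta> = \<epsilon> / 4"
    have \<delta>: "\<delta> > 0" "\<delta> < 1" "\<tau> - \<delta> > 0" using eps tau by (auto simp: \<delta>_def)
    define r where "r = nat \<lceil>5 / (2 * \<delta>)\<rceil>"
    have r: "real r \<ge> 5 / (2 * \<delta>)" unfolding r_def by linarith
    then have r0: "real r > 0" using \<delta> by (smt (verit) divide_pos_pos)
    then have r1: "r \<ge> 1" by simp
    have rd: "- \<delta> \<le> - 5 / (2 * r)" using r r0 \<delta> by (simp add: field_simps)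
    define c where "c = 4 * real r * real C"
    have c: "c > 0" using r0 C by (simp add: c_def)
    define good where "good E L \<longleftrightarrow> E \<in> sets lborel \<and> E \<subseteq> {0..1} \<and>
      measure lborel E \<le> (B' powr (- \<delta> / 2)) ^ L \<and>
      (\<forall>x\<in>{0..1} - E. D x (BL L) > real (BL L) powr (\<tau> - \<epsilon>))" for E L
    have ev: "\<forall>\<^sub>F L in sequentially. \<exists>E. good E L"
      using eventually_compose_filterlim[OF eventually_log_powr_bounds(1)[OF c \<delta>(1), of "t + (2 * r + 5)"] BL_lim]
        eventually_compose_filterlim[OF eventually_log_powr_bounds(2)[OF c \<delta>(1)] BL_lim]
        eventually_compose_filterlim[OF eventually_log_powr_bounds(3)[OF c \<delta>(1)] BL_lim]
        eventually_compose_filterlim[OF eventually_log_powr_bounds(3)[OF c \<delta>(3)] BL_lim]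
        eventually_compose_filterlim[OF eventually_ge_at_top[of 2] BL_lim]
        eventually_ge_at_top[of 1] integral_bound[OF \<delta>(1)]
    proof eventually_elim
      case (elim L)
      define N where "N = BL L"
      define I where "I = (LINT x|unit_lborel. norm (S N x))"
      have N: "real N \<ge> 2" "N \<ge> 2" using elim(5) by (simp_all add: N_def)
      have "I = (LINT \<alpha>:{0..1}|lborel.
           norm (\<Sum>n=1..BL L. exp (2 * pi * \<i> * complex_of_real (real_of_int (a n) * \<alpha>))))"
        unfolding I_def integral_unit_lborel S_def N_def e1_def cis_conv_exp by (simp add: mult_ac)
      then have I: "I > real N powr (\<tau> - \<delta>)" using elim(7) by (simp add: N_def)
      have I2: "I \<ge> 2" using I elim(4) by (simp add: N_def)
      define X where "X = real N powr \<delta>"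
      have X: "2 \<le> X" "X \<le> real N"
        using elim(3) powr_mono[of \<delta> 1 "real N"] \<delta> N by (simp_all add: X_def N_def)
      have K1: "C * N ^ t \<ge> 1" using C N by simp
      obtain E where E: "E \<in> sets lborel" "E \<subseteq> {0..1}"
        "measure lborel E \<le> 60 * ln (real N) * log 2 (4 * real r * real (C * N ^ t) * real N ^ (2 * r + 5)) / X"
        "\<And>x. x \<in> {0..1} - E \<Longrightarrow> D x N
           \<ge> I / (16 * pi * (log 2 (real N) + 1) * X) * real N powr (- 5 / (2 * r))"
        using discrepancy_large_off_small_set[OF N(2) C(2)[where N = N] K1 r1 X I_def[unfolded S_def] I2]
        unfolding D_def by blast
      have "measure lborel E \<le> 60 * ln (real N) * log 2 (c * real N ^ (t + (2 * r + 5))) / real N powr \<delta>"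
        using E(3) by (simp add: c_def X_def power_add mult_ac)
      also have "\<dots> \<le> real N powr (- \<delta> / 2)" using elim(1) by (simp add: N_def)
      \<comment> \<open>Exponential growth of \<open>BL\<close> turns a power saving in
        \<open>N\<close> into geometric decay in \<open>L\<close>, as summability in the
        Borel-Cantelli lemma requires.\<close>
      also have "\<dots> \<le> (B' ^ L) powr (- \<delta> / 2)"
        using BL_bounds[OF elim(6)] BB \<delta> by (intro powr_mono2') (auto simp: N_def)
      also have "\<dots> = (B' powr (- \<delta> / 2)) ^ L"
        using BB by (simp add: powr_realpow[symmetric] powr_powr powr_power mult_ac)
      finally have 1: "measure lborel E \<le> (B' powr (- \<delta> / 2)) ^ L" .
      have 2: "D x N > real N powr (\<tau> - \<epsilon>)" if x: "x \<in> {0..1} - E" for x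
      proof -
        define Q where "Q = 16 * pi * (log 2 (real N) + 1)"
        have Q: "Q > 0" "Q < real N powr \<delta>"
          using N elim(2) by (auto simp: Q_def N_def intro!: mult_pos_pos add_nonneg_pos)
        have "real N powr (\<tau> - \<epsilon>) = real N powr (\<tau> - \<delta>) / (real N powr \<delta> * X) * real N powr (- \<delta>)"
          using N by (simp add: X_def \<delta>_def powr_add[symmetric] powr_diff[symmetric])
        also have "\<dots> \<le> real N powr (\<tau> - \<delta>) / (real N powr \<delta> * X) * real N powr (- 5 / (2 * r))"
          using rd N X by (intro mult_left_mono powr_mono) auto
        also have "\<dots> < I / (Q * X) * real N powr (- 5 / (2 * r))"
          using I Q X N I2 by (intro mult_strict_right_mono frac_less) auto
        also have "\<dots> \<le> D x N" using E(4)[OF x] by (simp add: Q_def)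
        finally show ?thesis .
      qed
      show ?case
        unfolding good_def using E(1,2) 1 2 by (intro exI[of _ E]) (simp add: N_def)
    qed
    then obtain L0 where L0: "\<And>L. L \<ge> L0 \<Longrightarrow> \<exists>E. good E L" by (auto simp: eventually_sequentially)
    \<comment> \<open>The empty set as default makes measurability and the geometric bound hold for
      every \<open>L\<close>.\<close>
    define E where "E L = (if L \<ge> L0 then SOME E. good E L else {})" for L
    have E: "good (E L) L" if "L \<ge> L0" for L
      using someI_ex[OF L0[OF that]] that by (simp add: E_def)
    have Es: "E L \<in> sets lborel" "E L \<subseteq> {0..1}" "measure lborel (E L) \<le> (B' powr (- \<delta> / 2)) ^ L" for L
      using E[of L] by (cases "L \<ge> L0"; auto simp: good_def E_def)+
    have "AE x in lborel. \<forall>\<^sub>F L in sequentially. x \<in> space lborel - E L"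
    proof (rule borel_cantelli_AE1)
      have "B' powr (- \<delta> / 2) < 1" using BB \<delta> powr_less_mono[of "- \<delta> / 2" 0 B'] by simp
      then have "summable (\<lambda>L. (B' powr (- \<delta> / 2)) ^ L)"
        by (intro summable_geometric) simp
      then show "summable (\<lambda>L. measure lborel (E L))"
        by (rule summable_comparison_test'[where N = 0]) (use Es(3) in auto)
      fix L
      have "emeasure lborel (E L) \<le> emeasure lborel {0..1::real}"
        using Es by (intro emeasure_mono) auto
      also have "\<dots> < \<infinity>" by simp
      finally show "emeasure lborel (E L) < \<infinity>" .
    qed (use Es in auto)
    then show ?thesis
    proof eventually_elim
      case (elim x)
      show ?case
      proof
        assume x: "x \<in> {0..1}"
        show "\<forall>\<^sub>F L in sequentially. D x (BL L) > real (BL L) powr (\<tau> - \<epsilon>)"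
          using elim eventually_ge_at_top[of L0]
          by eventually_elim (use E x in \<open>auto simp: good_def\<close>)
      qed
    qed
  qed
  \<comment> \<open>A sequence in \<open>(0, \<tau>)\<close> tending to 0, so that a single null set
    serves every \<epsilon>. The summand 2 keeps \<open>\<eta> 0\<close> strictly below
    \<tau>.\<close>
  define \<eta> where "\<eta> k = \<tau> / (real k + 2)" for k
  have \<eta>: "0 < \<eta> k" "\<eta> k < \<tau>" for k
    using tau by (auto simp: \<eta>_def field_simps intro: add_pos_nonneg)
  have "AE \<alpha> in lborel. \<forall>k. \<alpha> \<in> {0..1} \<longrightarrow> (\<forall>\<^sub>F L in sequentially. D \<alpha> (BL L) > real (BL L) powr (\<tau> - \<eta> k))"
    unfolding AE_all_countable using main[OF \<eta>] by blast
  then show ?thesis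
  proof eventually_elim
    case (elim \<alpha>)
    show ?case
    proof (intro impI allI)
      fix \<epsilon> :: real assume \<alpha>: "\<alpha> \<in> {0..<1}" and \<epsilon>: "\<epsilon> > 0"
      obtain k :: nat where "real k > \<tau> / \<epsilon>" using reals_Archimedean2 by blast
      then have k: "\<eta> k \<le> \<epsilon>" using \<epsilon> tau by (simp add: \<eta>_def field_simps)
      have "\<forall>\<^sub>F L in sequentially. D \<alpha> (BL L) > real (BL L) powr (\<tau> - \<eta> k)" using elim \<alpha> by auto
      then have "\<forall>\<^sub>F L in sequentially. D \<alpha> (BL L) > real (BL L) powr (\<tau> - \<epsilon>)"
        using eventually_ge_at_top[of 1]
      proof eventually_elim
        case (elim L)
        have "real (BL L) powr (\<tau> - \<epsilon>) \<le> real (BL L) powr (\<tau> - \<eta> k)"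
          using k BL_pos[OF elim(2)] by (intro powr_mono) auto
        then show ?case using elim by linarith
      qed
      then have "\<exists>\<^sub>F L in sequentially. D \<alpha> (BL L) > real (BL L) powr (\<tau> - \<epsilon>)"
        by (rule eventually_frequently[rotated]) simp
      \<comment> \<open>If the bound failed for all large \<open>N\<close>, it would fail at
        \<open>N = BL L\<close> for all large \<open>L\<close>, because \<open>BL\<close> tends to
        infinity.\<close>
      then show "\<exists>\<^sub>F N in sequentially. real N * discrepancy (\<lambda>n. frac (real_of_int (a n) * \<alpha>)) N > real N powr (\<tau> - \<epsilon>)"
        unfolding D_def[symmetric] frequently_def
        using eventually_compose_filterlim[OF _ BL_lim_nat] by blast
    qed
  qed
qed

end
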